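(* For positive integers $k, t$, we have $b_{kt, t}=k$.
   Context: Let $H_{n,m}=\{0,1,\dots,n-1\}^m$. For $\ell\le m$, an $\ell$-rook is a point $P\in H_{n,m}$ together with a set $D$ of $\ell$ of the $m$ coordinate indices; it attacks every point of $H_{n,m}$ which differs from $P$ in exactly one coordinate, that coordinate belonging to $D$. Distinct rooks must occupy distinct points. $b_{n,m,\ell}$ is the maximum number of $\ell$-rooks that can be placed in $H_{n,m}$ so that no rook attacks the position of another rook, and $b_{m,\ell}=\lim_{n\to\infty} b_{n,m,\ell}/n^{m-1}$ (this limit exists). *)

theory Defs
  imports "HOL-Analysis.Analysis"
begin

definition grid :: "nat \<Rightarrow> nat \<Rightarrow> (nat \<Rightarrow> nat) set" where
  "grid n m = {..<m} \<rightarrow>\<^sub>E {..<n}"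

type_synonym rook = "(nat \<Rightarrow> nat) \<times> nat set"

definition rooks :: "nat \<Rightarrow> nat \<Rightarrow> nat \<Rightarrow> rook set" where
  "rooks n m l = {(P, D). P \<in> grid n m \<and> D \<subseteq> {..<m} \<and> card D = l}"

text \<open>There is no blocking: a rook attacks every point of the grid that differs from its position in
  exactly one coordinate, provided that this coordinate is one of its directions.\<close>

definition attacked :: "nat \<Rightarrow> nat \<Rightarrow> rook \<Rightarrow> (nat \<Rightarrow> nat) set" where
  "attacked n m r = {Q \<in> grid n m. \<exists>d \<in> snd r. {i. i < m \<and> Q i \<noteq> fst r i} = {d}}"

text \<open>A placement is a set of rooks; since no two rooks may share a point, no multiplicities are
  lost. Different rooks may have different direction sets.\<close>

definition placement :: "nat \<Rightarrow> nat \<Rightarrow> nat \<Rightarrow> rook set \<Rightarrow> bool" where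
  "placement n m l R \<longleftrightarrow>
     R \<subseteq> rooks n m l \<and> inj_on fst R \<and>
     (\<forall>r \<in> R. \<forall>s \<in> R. r \<noteq> s \<longrightarrow> fst s \<notin> attacked n m r)"

definition max_rooks :: "nat \<Rightarrow> nat \<Rightarrow> nat \<Rightarrow> nat" where
  "max_rooks n m l = Max (card ` {R. placement n m l R})"

definition rook_ratio :: "nat \<Rightarrow> nat \<Rightarrow> nat \<Rightarrow> real" where
  "rook_ratio m l n = real (max_rooks n m l) / real n ^ (m - 1)"

definition rook_limit :: "nat \<Rightarrow> nat \<Rightarrow> real" where
  "rook_limit m l = lim (rook_ratio m l)"

text \<open>The maximum is taken over a finite nonempty set, hence attained.\<close>

lemma finite_rooks: "finite (rooks n m l)"
proof -
  have "rooks n m l \<subseteq> grid n m \<times> Pow {..<m}"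
    by (auto simp: rooks_def)
  moreover have "finite (grid n m \<times> Pow {..<m})"
    by (auto simp: grid_def intro: finite_PiE)
  ultimately show ?thesis
    by (rule finite_subset)
qed

lemma finite_placements: "finite {R. placement n m l R}"
  by (rule finite_subset[of _ "Pow (rooks n m l)"])
     (auto simp: placement_def finite_rooks)

lemma placement_empty: "placement n m l {}"
  by (simp add: placement_def)

lemma max_rooks_attained: "\<exists>R. placement n m l R \<and> card R = max_rooks n m l"
proof -
  have "max_rooks n m l \<in> card ` {R. placement n m l R}"
    unfolding max_rooks_def using placement_empty
    by (intro Max_in finite_imageI finite_placements) auto
  then show ?thesis by auto
qed

lemma card_le_max_rooks: "placement n m l R \<Longrightarrow> card R \<le> max_rooks n m l"
  unfolding max_rooks_def by (intro Max_ge finite_imageI finite_placements) auto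

end

theory Submission
  imports Defs
begin

text \<open>
  Upper bound: a line in one of the directions of a rook contains no other rook, so \<open>l\<close>
  times the number of rooks is at most the number \<open>m n\<^sup>m\<^sup>-\<^sup>1\<close> of lines.

  Lower bound: split the \<open>k t\<close> coordinates into \<open>k\<close> consecutive blocks of length \<open>t\<close>. Put a
  rook on a point when exactly one of its block sums vanishes modulo \<open>n\<close>, and let its directions be
  that block. A step in such a direction destroys the only vanishing block sum, so it
  never hits another rook. Replacing the first coordinate of each block by the block sum
  modulo \<open>n\<close> is a bijection of the grid, which makes the rooks easy to count; it is enough to count
  those whose image has a single zero coordinate.
\<close>

lemma placement_upper_bound:
  assumes R: "placement n m l R"
  shows "l * card R \<le> m * n ^ (m - 1)"
proof -
  \<comment> \<open>A line parallel to axis \<open>d\<close> is encoded by \<open>d\<close> and the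
    values of the other coordinates. The map \<open>f\<close> sends a rook and one of its directions
    to the line through that rook, so its injectivity on such pairs is the whole bound.\<close>
  define L where "L = (SIGMA d:{..<m}. ({..<m} - {d}) \<rightarrow>\<^sub>E {..<n})"
  define f :: "rook \<times> nat \<Rightarrow> nat \<times> (nat \<Rightarrow> nat)"
    where "f = (\<lambda>(r, d). (d, restrict (fst r) ({..<m} - {d})))"
  have RS: "R \<subseteq> rooks n m l" using R by (simp add: placement_def)
  then have finR: "finite R" using finite_rooks finite_subset by blast
  have rk: "fst r \<in> {..<m} \<rightarrow>\<^sub>E {..<n}" "snd r \<subseteq> {..<m}" "card (snd r) = l" if "r \<in> R" for r
    using subsetD[OF RS that] by (auto simp: rooks_def grid_def split: prod.splits)
  have "inj_on f (SIGMA r:R. snd r)"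
  proof (rule inj_onI)
    fix x y assume x: "x \<in> (SIGMA r:R. snd r)" and y: "y \<in> (SIGMA r:R. snd r)" and eq: "f x = f y"
    obtain r d where xr: "x = (r, d)" "r \<in> R" "d \<in> snd r" using x by auto
    obtain s where ys: "y = (s, d)" "s \<in> R" using y eq xr by (auto simp: f_def)
    have "fst s i = fst r i" if "i < m" "i \<noteq> d" for i
    proof -
      have "restrict (fst s) ({..<m} - {d}) i = restrict (fst r) ({..<m} - {d}) i"
        using eq xr ys by (simp add: f_def)
      with that show ?thesis by simp
    qed
    then have sub: "{i. i < m \<and> fst s i \<noteq> fst r i} \<subseteq> {d}" by auto
    \<comment> \<open>Two rooks on one line agree off \<open>d\<close>. If they were different,
      \<open>inj_on fst\<close> would make them differ exactly at \<open>d\<close>, and since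
      \<open>d\<close> is a direction of \<open>r\<close>, the rook \<open>r\<close> would attack
      \<open>s\<close>.\<close>
    have "r = s"
    proof (rule ccontr)
      assume "r \<noteq> s"
      then have ne: "fst s \<noteq> fst r" and na: "fst s \<notin> attacked n m r"
        using R xr ys by (auto simp: placement_def dest: inj_onD)
      have "{i. i < m \<and> fst s i \<noteq> fst r i} \<noteq> {}"
        using ne PiE_ext[OF rk(1)[OF ys(2)] rk(1)[OF xr(2)]] by auto
      with sub have "{i. i < m \<and> fst s i \<noteq> fst r i} = {d}" by blast
      with na xr(3) rk(1)[OF ys(2)] show False by (auto simp: attacked_def grid_def)
    qed
    then show "x = y" using xr ys by simp
  qed
  moreover have "f ` (SIGMA r:R. snd r) \<subseteq> L"
    using rk by (fastforce simp: f_def L_def)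
  moreover have "finite L" by (auto simp: L_def intro!: finite_PiE)
  ultimately have "card (SIGMA r:R. snd r) \<le> card L" by (rule card_inj_on_le)
  also have "card L = m * n ^ (m - 1)"
    unfolding L_def by (subst card_SigmaI) (auto simp: card_PiE intro!: finite_PiE)
  also have "card (SIGMA r:R. snd r) = l * card R"
    using finR rk by (subst card_SigmaI) (auto intro: finite_subset[OF rk(2)])
  finally show ?thesis .
qed

text \<open>The common terms cancel, leaving two congruent numbers below \<open>n\<close>. This
  serves twice: to recover the one coordinate that \<open>block_sum_map\<close> overwrites in a
  block, and to see that changing a single coordinate always changes the block sum modulo
  \<open>n\<close>.\<close>

lemma sum_mod_eq_imp_eq:
  fixes f g :: "'a \<Rightarrow> nat"
  assumes "finite A" "d \<in> A" and eq: "sum f A mod n = sum g A mod n"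
    and same: "\<And>i. i \<in> A \<Longrightarrow> i \<noteq> d \<Longrightarrow> f i = g i"
    and "f d < n" "g d < n"
  shows "f d = g d"
proof -
  have "sum f (A - {d}) = sum g (A - {d})"
    using same by (intro sum.cong) auto
  then have "sum f A = f d + sum g (A - {d})" "sum g A = g d + sum g (A - {d})"
    using assms(1,2) by (simp_all add: sum.remove)
  \<comment> \<open>Over the integers the difference is not truncated; a positive multiple of
    \<open>n\<close> would be at least \<open>n\<close>, whichever of the two numbers is
    larger.\<close>
  with eq have "(int (f d) + int (sum g (A - {d}))) mod int n
      = (int (g d) + int (sum g (A - {d}))) mod int n"
    by (metis of_nat_add zmod_int)
  then have "int n dvd int (f d) - int (g d)"
    by (simp add: mod_eq_dvd_iff)
  then show ?thesis
    using assms(5,6) zdvd_imp_le[of "int n" "int (f d) - int (g d)"]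
      zdvd_imp_le[of "int n" "int (g d) - int (f d)"]
    by (cases "f d" "g d" rule: linorder_cases) (auto simp: dvd_diff_commute)
qed

abbreviation block :: "nat \<Rightarrow> nat \<Rightarrow> nat set" where
  "block t j \<equiv> {j * t..<j * t + t}"

lemma block_subset: "j < k \<Longrightarrow> block t j \<subseteq> {..<k * t}"
  using mult_le_mono1[of "Suc j" k t] by auto

text \<open>This is why \<open>block_sum_map\<close> overwrites only the first coordinate of each
  block.\<close>

lemma block_dvd: "i \<in> block t j \<Longrightarrow> t dvd i \<Longrightarrow> i = j * t"
  by (auto simp: dvd_def) (metis mult.commute add.commute mult_Suc mult_less_cancel2
      le_antisym less_Suc_eq_le)

lemma block_disjoint: "d \<in> block t i \<Longrightarrow> d \<in> block t j \<Longrightarrow> i = j"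
  by (metis atLeastLessThan_iff add.commute div_nat_eqI mult.commute mult_Suc)

text \<open>Testing \<open>t dvd p\<close> recognises the start of a block without naming its index;
  \<open>restrict\<close> keeps the result extensional, as \<open>grid\<close> demands.\<close>

definition block_sum_map :: "nat \<Rightarrow> nat \<Rightarrow> nat \<Rightarrow> (nat \<Rightarrow> nat) \<Rightarrow> nat \<Rightarrow> nat" where
  "block_sum_map n m t P =
     restrict (\<lambda>p. if t dvd p then (\<Sum>i\<in>{p..<p + t}. P i) mod n else P p) {..<m}"

lemma block_sum_map_pivot:
  "j < k \<Longrightarrow> t > 0 \<Longrightarrow> block_sum_map n (k * t) t P (j * t) = sum P (block t j) mod n"
  by (simp add: block_sum_map_def)

text \<open>The grid is finite, so injectivity suffices. Coordinates that do not start a block are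
  copied, and the first one of a block is then determined by the block sum modulo
  \<open>n\<close>.\<close>

lemma bij_betw_block_sum_map:
  assumes t: "t > 0" and n: "n > 0"
  shows "bij_betw (block_sum_map n (k * t) t) (grid n (k * t)) (grid n (k * t))"
proof -
  let ?\<Phi> = "block_sum_map n (k * t) t" and ?G = "grid n (k * t)"
  have fin: "finite ?G" by (auto simp: grid_def intro: finite_PiE)
  have img: "?\<Phi> ` ?G \<subseteq> ?G"
  proof (rule image_subsetI)
    fix P assume "P \<in> ?G"
    then have "P p < n" if "p < k * t" for p using that by (auto simp: grid_def)
    then show "?\<Phi> P \<in> ?G"
      using n by (simp add: block_sum_map_def grid_def restrict_PiE_iff)
  qed
  have inj: "inj_on ?\<Phi> ?G"
  proof (rule inj_onI)
    fix P Q assume P: "P \<in> ?G" and Q: "Q \<in> ?G" and eq: "?\<Phi> P = ?\<Phi> Q"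
    have nd: "P p = Q p" if "p < k * t" "\<not> t dvd p" for p
      using fun_cong[OF eq, of p] that by (simp add: block_sum_map_def)
    have "P p = Q p" if p: "p < k * t" for p
    proof (cases "t dvd p")
      case True
      then obtain j where j: "p = j * t" by (metis dvdE mult.commute)
      have jk: "j < k" using p j by simp
      have "P (j * t) = Q (j * t)"
      proof (rule sum_mod_eq_imp_eq[of "block t j" _ P n Q])
        show "sum P (block t j) mod n = sum Q (block t j) mod n"
          using fun_cong[OF eq, of "j * t"] jk t by (simp only: block_sum_map_pivot)
        show "P i = Q i" if "i \<in> block t j" "i \<noteq> j * t" for i
          using that nd block_dvd block_subset[OF jk] by blast
        show "P (j * t) < n" "Q (j * t) < n"
          using PiE_mem[of P "{..<k * t}" "\<lambda>_. {..<n}" p] PiE_mem[of Q "{..<k * t}" "\<lambda>_. {..<n}" p]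
            P Q p j by (simp_all add: grid_def)
      qed (use t in auto)
      then show ?thesis using j by simp
    qed (use nd p in auto)
    then show "P = Q"
      using PiE_ext[OF P[unfolded grid_def] Q[unfolded grid_def]] by (metis lessThan_iff)
  qed
  show ?thesis using endo_inj_surj[OF fin img inj] inj by (simp add: bij_betw_def)
qed

lemma max_rooks_lower_bound:
  assumes t: "t > 0" and n: "n > 0"
  shows "k * (n - 1) ^ (k * t - 1) \<le> max_rooks n (k * t) t"
proof -
  let ?m = "k * t"
  let ?\<Phi> = "block_sum_map n ?m t" and ?G = "grid n ?m"
  \<comment> \<open>\<open>B j\<close> has one zero, at the start of block \<open>j\<close>, and
    \<open>n - 1\<close> choices at every other coordinate. Its size is therefore a plain power of
    \<open>n - 1\<close>, with the same leading term as \<open>n ^ (?m - 1)\<close>.\<close>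
  define B where "B j = (\<Pi>\<^sub>E p\<in>{..<?m}. if p = j * t then {0} else {1..<n})" for j
  define A where "A j = {P \<in> ?G. ?\<Phi> P \<in> B j}" for j
  define R where "R = (\<Union>j\<in>{..<k}. (\<lambda>P. (P, block t j)) ` A j)"
  have bij: "bij_betw ?\<Phi> ?G ?G" by (rule bij_betw_block_sum_map[OF t n])
  have finA: "finite (A j)" for j
    unfolding A_def grid_def by (rule finite_Collect_conjI) (simp add: finite_PiE)
  have pivot_less: "j * t < ?m" if "j < k" for j using that t by simp
  have card_A: "card (A j) = (n - 1) ^ (?m - 1)" if j: "j < k" for j
  proof -
    have "B j \<subseteq> ?G"
      unfolding B_def grid_def using n by (intro PiE_mono) auto
    then have "?\<Phi> ` A j = B j"
      using bij by (auto simp: A_def bij_betw_def)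
    moreover have "inj_on ?\<Phi> (A j)"
      using bij by (auto simp: A_def bij_betw_def intro: inj_on_subset)
    ultimately have "card (A j) = card (B j)" by (metis card_image)
    also have "\<dots> = (\<Prod>p<?m. if p = j * t then 1 else n - 1)"
      unfolding B_def by (subst card_PiE) (auto intro!: prod.cong)
    also have "\<dots> = (\<Prod>p\<in>{..<?m} - {j * t}. n - 1)"
      using pivot_less[OF j] by (subst prod.remove[of _ "j * t"]) (auto intro!: prod.cong)
    finally show ?thesis using pivot_less[OF j] by simp
  qed
  \<comment> \<open>The position alone thus determines the block, so the sets \<open>A j\<close> are
    disjoint and no point carries two rooks.\<close>
  have zero_iff: "sum P (block t i) mod n = 0 \<longleftrightarrow> i = j" if "P \<in> A j" "i < k" for P i j
  proof -
    have "?\<Phi> P (i * t) \<in> (if i * t = j * t then {0} else {1..<n})"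
      using that pivot_less[of i] unfolding A_def B_def by blast
    then show ?thesis using that t by (auto simp: block_sum_map_pivot split: if_splits)
  qed
  have "placement n ?m t R"
    unfolding placement_def
  proof (intro conjI ballI impI)
    show "R \<subseteq> rooks n ?m t"
      using block_subset by (fastforce simp: R_def A_def rooks_def)
    show "inj_on fst R"
    proof (rule inj_onI)
      fix r s assume "r \<in> R" "s \<in> R" and eq: "fst r = fst s"
      then obtain P j i where "r = (P, block t j)" "s = (P, block t i)"
        "P \<in> A j" "P \<in> A i" "j < k" "i < k"
        by (auto simp: R_def)
      then show "r = s" using zero_iff by metis
    qed
    fix r s assume rs: "r \<in> R" "s \<in> R" "r \<noteq> s"
    obtain P j where r: "r = (P, block t j)" "P \<in> A j" "j < k" using rs by (auto simp: R_def)
    obtain Q i where s: "s = (Q, block t i)" "Q \<in> A i" "i < k" using rs by (auto simp: R_def)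
    show "fst s \<notin> attacked n ?m r"
    proof
      assume "fst s \<in> attacked n ?m r"
      then obtain d where d: "d \<in> block t j" "{p. p < ?m \<and> Q p \<noteq> P p} = {d}"
        using r s by (auto simp: attacked_def)
      have dm: "d < ?m" "Q d \<noteq> P d" using d by auto
      have same: "Q p = P p" if "p < ?m" "p \<noteq> d" for p using d that by auto
      show False
      proof (cases "i = j")
        case True
        \<comment> \<open>Both points have vanishing sum over block \<open>j\<close> and differ only
          at \<open>d\<close> in that block, which forces equality at \<open>d\<close> as
          well.\<close>
        have "Q d = P d"
        proof (rule sum_mod_eq_imp_eq[of "block t j" _ Q n P])
          show "sum Q (block t j) mod n = sum P (block t j) mod n"
            using zero_iff r s True by metis
          show "Q p = P p" if "p \<in> block t j" "p \<noteq> d" for p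
            using that same block_subset[OF r(3)] by blast
          show "Q d < n" "P d < n" using r s dm by (auto simp: A_def grid_def)
        qed (use d in auto)
        then show False using dm by simp
      next
        case False
        \<comment> \<open>The step along \<open>d\<close> leaves block \<open>i\<close> untouched,
          so its sum, which vanishes at \<open>Q\<close>, vanishes at \<open>P\<close> too; but at
          \<open>P\<close> only block \<open>j\<close> may do so.\<close>
        then have "d \<notin> block t i" using d block_disjoint by blast
        then have "sum Q (block t i) = sum P (block t i)"
          using same block_subset[OF s(3)] by (intro sum.cong) blast+
        then show False using zero_iff[OF r(2) s(3)] zero_iff[OF s(2) s(3)] False by simp
      qed
    qed
  qed
  then have "card R \<le> max_rooks n ?m t" by (rule card_le_max_rooks)
  moreover have "card R = (\<Sum>j<k. card ((\<lambda>P. (P, block t j)) ` A j))"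
    unfolding R_def
  proof (rule card_UN_disjoint)
    show "\<forall>i\<in>{..<k}. \<forall>j\<in>{..<k}. i \<noteq> j \<longrightarrow>
        (\<lambda>P. (P, block t i)) ` A i \<inter> (\<lambda>P. (P, block t j)) ` A j = {}"
    proof (intro ballI impI)
      fix i j assume "i \<in> {..<k}" "i \<noteq> j"
      then have "A i \<inter> A j = {}" using zero_iff by (metis disjoint_iff lessThan_iff)
      then show "(\<lambda>P. (P, block t i)) ` A i \<inter> (\<lambda>P. (P, block t j)) ` A j = {}" by blast
    qed
  qed (use finA in auto)
  moreover have "\<dots> = (\<Sum>j<k. (n - 1) ^ (?m - 1))"
    by (intro sum.cong) (auto simp: card_image inj_on_def card_A)
  ultimately show ?thesis by simp
qed

text \<open>After division by \<open>n ^ (k * t - 1)\<close> the lower bound becomes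
  \<open>k * (1 - 1 / n) ^ (k * t - 1)\<close>, which tends to \<open>k\<close>.\<close>

lemma rook_ratio_tendsto:
  assumes t: "t > 0"
  shows "rook_ratio (k * t) t \<longlonglongrightarrow> real k"
proof (rule tendsto_sandwich)
  let ?m = "k * t"
  show "eventually (\<lambda>n. real k * (1 - 1 / real n) ^ (?m - 1) \<le> rook_ratio ?m t n) sequentially"
    using eventually_gt_at_top[of 0]
  proof eventually_elim
    case (elim n)
    have "real (k * (n - 1) ^ (?m - 1)) \<le> real (max_rooks n ?m t)"
      using max_rooks_lower_bound[OF t elim] by (rule of_nat_mono)
    moreover have "1 - 1 / real n = real (n - 1) / real n"
      using elim by (simp add: field_simps of_nat_diff)
    ultimately show ?case
      using elim by (simp add: rook_ratio_def power_divide divide_right_mono)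
  qed
  show "eventually (\<lambda>n. rook_ratio ?m t n \<le> real k) sequentially"
    using eventually_gt_at_top[of 0]
  proof eventually_elim
    case (elim n)
    obtain R where "placement n ?m t R" "card R = max_rooks n ?m t"
      using max_rooks_attained by blast
    \<comment> \<open>There are \<open>k * t\<close> axes and each rook uses up \<open>t\<close>
      lines, so cancelling \<open>t\<close> leaves exactly the factor \<open>k\<close>.\<close>
    then have "t * max_rooks n ?m t \<le> t * (k * n ^ (?m - 1))"
      using placement_upper_bound[of n ?m t R] by (simp add: ac_simps del: mult_le_cancel1)
    then have "max_rooks n ?m t \<le> k * n ^ (?m - 1)" using t by simp
    then have "real (max_rooks n ?m t) \<le> real (k * n ^ (?m - 1))" by (rule of_nat_mono)
    then show ?case using elim by (simp add: rook_ratio_def divide_le_eq)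
  qed
  have "(\<lambda>n. real k * (1 - 1 / real n) ^ (?m - 1)) \<longlonglongrightarrow> real k * (1 - 0) ^ (?m - 1)"
    by (intro tendsto_intros lim_1_over_n)
  then show "(\<lambda>n. real k * (1 - 1 / real n) ^ (?m - 1)) \<longlonglongrightarrow> real k" by simp
qed simp

theorem theorem18:
  fixes k t :: nat
  assumes "k > 0" and "t > 0"
  shows "convergent (rook_ratio (k * t) t) \<and> rook_limit (k * t) t = real k"
  using rook_ratio_tendsto[OF assms(2), of k]
  by (auto simp: convergent_def rook_limit_def dest: limI)

end
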